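(* Let $\{\mathcal{P}_n\}_{n\ge0}$ be the $R_{II}$ polynomials given in the context. Let $\mathcal{L}_n(x)=\mathcal{P}_n(x)-\alpha_n\mathcal{P}_{n-1}(x)$, $n\ge0$, with $\alpha_n\in\mathbb{R}\setminus\{0\}$, and let $\mathcal{T}_n(x)=\mathcal{P}_n(x)-\beta_n\mathcal{P}_{n-1}(x)$, $n\ge0$, with $\beta_n\in\mathbb{R}\setminus\{0\}$, be another class of $R_{II}$ polynomials, where $\{\beta_n\}$ satisfies for all $n\ge1$ $$-\beta_{n-1}\rho_{n-1}=d_{n-1}\omega^2+\beta_{n-1}(\beta_n+\rho_{n-1}c_{n-1}),\qquad d_n\beta_{n-1}\rho_{n-1}=d_{n-1}\beta_n\rho_n .$$ Then, whenever $\alpha_n\ne\beta_n$ $(n\ge1)$, $\mathcal{L}_n(x)$ and $\mathcal{T}_n(x)$ have no common zeros and their zeros interlace.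
   Context: Here $\omega\in\mathbb{R}\setminus\{0\}$; $\{\rho_n\}_{n\ge0}$, $\{c_n\}_{n\ge0}$ are real sequences with $\rho_n\ge1$; $\{d_n\}_{n\ge1}$ is a positive chain sequence, i.e. there is $\{\xi_n\}_{n\ge0}$ with $0\le\xi_0<1$, $0<\xi_n<1$ $(n\ge1)$ and $d_n=(1-\xi_{n-1})\xi_n$. The $R_{II}$ polynomials $\mathcal{P}_n$ are generated by $\mathcal{P}_{-1}=0$, $\mathcal{P}_0=1$, $\mathcal{P}_1=\rho_0(x-c_0)$ and $\mathcal{P}_{n+1}(x)=\rho_n(x-c_n)\mathcal{P}_n(x)-d_n(x^2+\omega^2)\mathcal{P}_{n-1}(x)$ for $n\ge1$. The constants $d_0$ and $\beta_0$ in the conditions at $n=1$ are auxiliary real constants that do not influence the polynomials. "Zeros interlace" means that all zeros are real and simple and between any two consecutive zeros of one polynomial there is exactly one zero of the other. *)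

theory Defs
  imports Complex_Main "HOL-Computational_Algebra.Polynomial"
begin

text \<open>Sequences indexed from 1, such as the chain sequence \<open>d\<close>, are functions on \<^typ>\<open>nat\<close>;
  the value \<open>d 0\<close> is unconstrained here and does not enter the recurrence.\<close>

definition positive_chain_sequence :: "(nat \<Rightarrow> real) \<Rightarrow> bool" where
  "positive_chain_sequence d \<longleftrightarrow>
     (\<exists>\<xi> :: nat \<Rightarrow> real. 0 \<le> \<xi> 0 \<and> \<xi> 0 < 1 \<and>
        (\<forall>n\<ge>1. 0 < \<xi> n \<and> \<xi> n < 1 \<and> d n = (1 - \<xi> (n - 1)) * \<xi> n))"

fun RII_poly :: "real \<Rightarrow> (nat \<Rightarrow> real) \<Rightarrow> (nat \<Rightarrow> real) \<Rightarrow> (nat \<Rightarrow> real) \<Rightarrow> nat \<Rightarrow> real poly" where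
  "RII_poly \<omega> \<rho> c d 0 = 1"
| "RII_poly \<omega> \<rho> c d (Suc 0) = smult (\<rho> 0) [:- c 0, 1:]"
| "RII_poly \<omega> \<rho> c d (Suc (Suc n)) =
     smult (\<rho> (Suc n)) [:- c (Suc n), 1:] * RII_poly \<omega> \<rho> c d (Suc n)
     - smult (d (Suc n)) [:\<omega>\<^sup>2, 0, 1:] * RII_poly \<omega> \<rho> c d n"

definition RII_class :: "real \<Rightarrow> (nat \<Rightarrow> real poly) \<Rightarrow> bool" where
  "RII_class \<omega> p \<longleftrightarrow>
     (\<exists>\<rho> c d. (\<forall>n. \<rho> n \<ge> 1) \<and> positive_chain_sequence d \<and> p = RII_poly \<omega> \<rho> c d)"

text \<open>\<open>prev_poly P n\<close> is $P_{n-1}$, with the convention $P_{-1} = 0$.\<close>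

definition prev_poly :: "(nat \<Rightarrow> real poly) \<Rightarrow> nat \<Rightarrow> real poly" where
  "prev_poly P n = (case n of 0 \<Rightarrow> 0 | Suc m \<Rightarrow> P m)"

text \<open>Zeros are complex zeros, so that realness of the zeros is a genuine claim.\<close>

definition is_zero_of :: "complex \<Rightarrow> real poly \<Rightarrow> bool" where
  "is_zero_of z p \<longleftrightarrow> poly (map_poly complex_of_real p) z = 0"

definition no_common_zeros :: "real poly \<Rightarrow> real poly \<Rightarrow> bool" where
  "no_common_zeros p q \<longleftrightarrow> \<not> (\<exists>z. is_zero_of z p \<and> is_zero_of z q)"

definition zeros_real_simple :: "real poly \<Rightarrow> bool" where
  "zeros_real_simple p \<longleftrightarrow>
     (\<forall>z. is_zero_of z p \<longrightarrow> z \<in> \<real> \<and> order z (map_poly complex_of_real p) = 1)"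

definition consecutive_zeros :: "real poly \<Rightarrow> real \<Rightarrow> real \<Rightarrow> bool" where
  "consecutive_zeros p x y \<longleftrightarrow>
     x < y \<and> poly p x = 0 \<and> poly p y = 0 \<and> (\<forall>t. x < t \<and> t < y \<longrightarrow> poly p t \<noteq> 0)"

definition zeros_interlace :: "real poly \<Rightarrow> real poly \<Rightarrow> bool" where
  "zeros_interlace p q \<longleftrightarrow>
     zeros_real_simple p \<and> zeros_real_simple q \<and>
     (\<forall>x y. consecutive_zeros p x y \<longrightarrow> (\<exists>!z. x < z \<and> z < y \<and> poly q z = 0)) \<and>
     (\<forall>x y. consecutive_zeros q x y \<longrightarrow> (\<exists>!z. x < z \<and> z < y \<and> poly p z = 0))"

end

theory Submission
  imports Defs
begin

text \<open>
  For real $a \ne b$, the polynomials $P_{n+1} - a P_n$ and $P_{n+1} - b P_n$ have interlacing zeros.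
  Write $d_{n+1} = (1 - \xi_n)\,\xi_{n+1}$. Two lower bounds are propagated along the recurrence,
  both by completing a square, with the chain sequence providing exactly the constant needed.

  \<^item> In the open upper half-plane, $\mathrm{Im}\,(P_{n+1}(z)/P_n(z)) \ge (1 - \xi_n)\,\mathrm{Im}\,z$
    (\<open>RII_ratio_Im\<close>). Hence the ratio takes no real value there, and by conjugation
    $P_{n+1} - a P_n$ has no nonreal zero for real $a$.

  \<^item> On the real line the Wronskian satisfies
    $P_{n+1}' P_n - P_{n+1} P_n' \ge (1 - \xi_n) P_n^2$ and it is positive
    (\<open>RII_wronskian\<close>); positivity uses $\omega \ne 0$.

  The Wronskian of $P_{n+1} - a P_n$ and $P_{n+1} - b P_n$ is $a - b$ times the one of
  $P_{n+1}$ and $P_n$, so it vanishes nowhere. This makes all zeros simple, excludes common zeros, and by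
  Rolle's theorem for the quotient forces a zero of either combination strictly between any two
  zeros of the other (\<open>zero_between\<close>); applied in both directions, this is interlacing.
\<close>

section \<open>Real polynomials with nowhere vanishing Wronskian\<close>

text \<open>The sign is chosen so that the Wronskian of two consecutive $R_{II}$ polynomials,
  the one of higher index first, is positive.\<close>

definition wronskian :: "'a::idom poly \<Rightarrow> 'a poly \<Rightarrow> 'a poly" where
  "wronskian p q = pderiv p * q - p * pderiv q"

lemma wronskian_commute: "wronskian q p = - wronskian p q"
  by (simp add: wronskian_def algebra_simps)

lemma wronskian_diff_smult:
  "wronskian (p - smult a q) (p - smult b q) = smult (a - b) (wronskian p q)"
  unfolding wronskian_def
  by (simp add: pderiv_diff pderiv_smult smult_diff_left smult_diff_right algebra_simps)

text \<open>If \<open>q\<close> had no zero between two zeros of \<open>p\<close>, Rolle's theorem for the quotient \<open>p / q\<close>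
  would produce a zero of the Wronskian.\<close>

lemma zero_between:
  fixes p q :: "real poly"
  assumes W: "\<And>t. poly (wronskian p q) t \<noteq> 0"
    and "x < y" "poly p x = 0" "poly p y = 0"
  shows "\<exists>z. x < z \<and> z < y \<and> poly q z = 0"
proof (rule ccontr)
  assume none: "\<not> ?thesis"
  have "poly q x \<noteq> 0" "poly q y \<noteq> 0"
    using W[of x] W[of y] assms(3,4) by (auto simp: wronskian_def)
  with none have q0: "poly q t \<noteq> 0" if "x \<le> t" "t \<le> y" for t
    using that by (cases "t = x"; cases "t = y") auto
  let ?f = "\<lambda>t. poly p t / poly q t"
  let ?f' = "\<lambda>t. (poly (pderiv p) t * poly q t - poly p t * poly (pderiv q) t)
                    / (poly q t * poly q t)"
  have D: "(?f has_real_derivative ?f' t) (at t)" if "x \<le> t" "t \<le> y" for t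
    using q0[OF that] by (intro DERIV_divide poly_DERIV)
  have "continuous_on {x..y} ?f"
    by (intro continuous_intros) (use q0 in auto)
  moreover have "?f x = ?f y" using assms by simp
  ultimately obtain z where z: "x < z" "z < y" "DERIV ?f z :> 0"
    using Rolle[of x y ?f] D \<open>x < y\<close> by (meson less_imp_le real_differentiable_def)
  then have "?f' z = 0"
    using D[of z] DERIV_unique by fastforce
  then show False
    using q0[of z] z W[of z] by (simp add: wronskian_def)
qed

text \<open>Two zeros of \<open>q\<close> between consecutive zeros of \<open>p\<close> would enclose a further zero of \<open>p\<close>,
  by the previous lemma with the roles exchanged.\<close>

lemma unique_zero_between:
  fixes p q :: "real poly"
  assumes W: "\<And>t. poly (wronskian p q) t \<noteq> 0" and "consecutive_zeros p x y"
  shows "\<exists>!z. x < z \<and> z < y \<and> poly q z = 0"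
proof -
  have xy: "x < y" "poly p x = 0" "poly p y = 0" "\<And>t. x < t \<Longrightarrow> t < y \<Longrightarrow> poly p t \<noteq> 0"
    using assms(2) by (auto simp: consecutive_zeros_def)
  have W': "poly (wronskian q p) t \<noteq> 0" for t
    using W[of t] by (simp add: wronskian_commute[of q p])
  have no_two: False if "x < z" "z < w" "w < y" "poly q z = 0" "poly q w = 0" for z w
    using zero_between[OF W' that(2,4,5)] xy(4) that by (meson less_trans)
  show ?thesis
    using zero_between[OF W xy(1-3)] no_two by (metis linorder_neqE_linordered_idom)
qed

section \<open>Complex zeros of real polynomials\<close>

text \<open>The value of a real polynomial at a complex point.\<close>

abbreviation cpoly :: "real poly \<Rightarrow> complex \<Rightarrow> complex" where
  "cpoly p z \<equiv> poly (map_poly complex_of_real p) z"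

lemma cpoly_diff: "cpoly (p - q) z = cpoly p z - cpoly q z"
proof -
  have "map_poly complex_of_real (p - q) = map_poly complex_of_real p - map_poly complex_of_real q"
    by (rule poly_eqI) (simp add: coeff_map_poly)
  then show ?thesis by simp
qed

lemma cpoly_add: "cpoly (p + q) z = cpoly p z + cpoly q z"
proof -
  have "map_poly complex_of_real (p + q) = map_poly complex_of_real p + map_poly complex_of_real q"
    by (rule poly_eqI) (simp add: coeff_map_poly)
  then show ?thesis by simp
qed

lemma cpoly_smult: "cpoly (smult a p) z = of_real a * cpoly p z"
  by (simp add: map_poly_smult)

lemma cpoly_mult: "cpoly (p * q) z = cpoly p z * cpoly q z"
  by (induction p) (simp_all add: cpoly_add cpoly_smult map_poly_pCons algebra_simps)

lemma cpoly_of_real: "cpoly p (of_real x) = of_real (poly p x)"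
  by (induction p) (simp_all add: map_poly_pCons)

lemma pderiv_map_of_real:
  "pderiv (map_poly complex_of_real p) = map_poly complex_of_real (pderiv p)"
  by (rule poly_eqI) (simp add: coeff_pderiv coeff_map_poly)

lemma is_zero_of_cnj: "is_zero_of (cnj z) p \<longleftrightarrow> is_zero_of z p"
  unfolding is_zero_of_def
  by (subst real_poly_cnj_root_iff) (auto simp: coeff_map_poly)

text \<open>Nonreal zeros come in conjugate pairs, so it suffices to exclude the open upper half-plane.\<close>

lemma zeros_real_simpleI:
  assumes nonreal: "\<And>z. Im z > 0 \<Longrightarrow> \<not> is_zero_of z p"
    and simple: "\<And>x. poly p x = 0 \<Longrightarrow> poly (pderiv p) x \<noteq> 0"
  shows "zeros_real_simple p"
  unfolding zeros_real_simple_def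
proof (intro allI impI conjI)
  fix z assume z: "is_zero_of z p"
  then have "Im z = 0"
    using nonreal[of z] nonreal[of "cnj z"]
    by (cases "Im z" "0::real" rule: linorder_cases) (auto simp: is_zero_of_cnj)
  then have zx: "z = of_real (Re z)" by (simp add: complex_eq_iff)
  then show "z \<in> \<real>" by (metis Reals_of_real)
  let ?p = "map_poly complex_of_real p"
  have "poly p (Re z) = 0"
    using z zx cpoly_of_real[of p "Re z"] by (simp add: is_zero_of_def)
  then have d: "poly (pderiv ?p) z \<noteq> 0"
    using simple[of "Re z"] zx cpoly_of_real[of "pderiv p" "Re z"]
    by (simp add: pderiv_map_of_real)
  then have "pderiv ?p \<noteq> 0" by auto
  moreover from this have "?p \<noteq> 0" by auto
  ultimately show "order z ?p = 1"
    using z d order_pderiv[of ?p z] order_root[of ?p z] order_0I[of "pderiv ?p" z]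
    by (auto simp: is_zero_of_def)
qed

lemma interlaceI:
  assumes W: "\<And>t. poly (wronskian p q) t \<noteq> 0"
    and "\<And>z. Im z > 0 \<Longrightarrow> \<not> is_zero_of z p" "\<And>z. Im z > 0 \<Longrightarrow> \<not> is_zero_of z q"
  shows "no_common_zeros p q \<and> zeros_interlace p q"
proof
  have W': "poly (wronskian q p) t \<noteq> 0" for t
    using W[of t] by (simp add: wronskian_commute[of q p])
  have real: "zeros_real_simple p" "zeros_real_simple q"
    using W by (auto intro!: zeros_real_simpleI assms(2,3) simp: wronskian_def)
      (metis diff_self mult_zero_left mult_zero_right)+
  show "zeros_interlace p q"
    unfolding zeros_interlace_def
    using real unique_zero_between[OF W] unique_zero_between[OF W'] by blast
  show "no_common_zeros p q"
    unfolding no_common_zeros_def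
  proof
    assume "\<exists>z. is_zero_of z p \<and> is_zero_of z q"
    then obtain z where z: "is_zero_of z p" "is_zero_of z q" by blast
    then have "z \<in> \<real>" using real by (auto simp: zeros_real_simple_def)
    then obtain x where "z = of_real x" by (auto elim: Reals_cases)
    then have "poly p x = 0" "poly q x = 0"
      using z by (simp_all add: is_zero_of_def cpoly_of_real)
    then show False using W[of x] by (simp add: wronskian_def)
  qed
qed

section \<open>The two bounds for consecutive $R_{II}$ polynomials\<close>

lemma cpoly_RII_Suc_Suc:
  "cpoly (RII_poly \<omega> \<rho> c d (Suc (Suc n))) z =
     of_real (\<rho> (Suc n)) * (z - of_real (c (Suc n))) * cpoly (RII_poly \<omega> \<rho> c d (Suc n)) z
     - of_real (d (Suc n)) * (z\<^sup>2 + of_real (\<omega>\<^sup>2)) * cpoly (RII_poly \<omega> \<rho> c d n) z"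
  unfolding RII_poly.simps(3) cpoly_diff cpoly_mult cpoly_smult
  by (simp add: map_poly_pCons power2_eq_square algebra_simps)

text \<open>One step of the recurrence for the ratio \<open>R\<close> of consecutive polynomials at a point \<open>z\<close> of the
  upper half-plane, with \<open>g\<close> in the role of $1 - \xi_n$ and \<open>\<xi>\<close> in that of $\xi_{n+1}$.\<close>

lemma half_plane_step:
  fixes R z :: complex and c \<omega> \<xi> g \<rho> :: real
  assumes z: "Im z > 0" and R: "Im R \<ge> g * Im z" and g: "g > 0" and \<xi>: "\<xi> > 0" and \<rho>: "\<rho> \<ge> 1"
  shows "Im (of_real \<rho> * (z - of_real c) - of_real (g * \<xi>) * (z\<^sup>2 + of_real (\<omega>\<^sup>2)) / R)
           \<ge> (1 - \<xi>) * Im z"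
proof -
  define s t u v where "s = Re z" "t = Im z" "u = Re R" "v = Im R"
  note defs = this
  have t: "t > 0" and v: "v \<ge> g * t" using z R by (auto simp: defs)
  then have v0: "v > 0" using g by (smt (verit) mult_pos_pos)
  then have pos: "u\<^sup>2 + v\<^sup>2 > 0" by (simp add: add_nonneg_pos)
  \<comment> \<open>Completing the square in \<open>u\<close> leaves terms that the hypothesis \<open>v \<ge> g * t\<close> makes nonnegative.\<close>
  have "0 \<le> t * (u - g * s)\<^sup>2 + g * s\<^sup>2 * (v - g * t) + t * v * (v - g * t) + g * \<omega>\<^sup>2 * v"
    using t v v0 g by simp
  also have "\<dots> = t * (u\<^sup>2 + v\<^sup>2) - g * (2 * s * t * u - (s\<^sup>2 - t\<^sup>2 + \<omega>\<^sup>2) * v)"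
    by (simp add: power2_eq_square algebra_simps)
  finally have "\<xi> * (g * (2 * s * t * u - (s\<^sup>2 - t\<^sup>2 + \<omega>\<^sup>2) * v)) \<le> \<xi> * (t * (u\<^sup>2 + v\<^sup>2))"
    using \<xi> by simp
  then have le: "g * \<xi> * (2 * s * t * u - (s\<^sup>2 - t\<^sup>2 + \<omega>\<^sup>2) * v) / (u\<^sup>2 + v\<^sup>2) \<le> \<xi> * t"
    using pos by (simp add: pos_divide_le_eq mult_ac)
  have "Im (of_real (g * \<xi>) * (z\<^sup>2 + of_real (\<omega>\<^sup>2)) / R)
          = g * \<xi> * (2 * s * t * u - (s\<^sup>2 - t\<^sup>2 + \<omega>\<^sup>2) * v) / (u\<^sup>2 + v\<^sup>2)"
    by (simp add: Im_divide defs power2_eq_square algebra_simps)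
  moreover have "Im (of_real \<rho> * (z - of_real c)) = \<rho> * t" by (simp add: defs)
  moreover have "\<rho> * t \<ge> 1 * t" using \<rho> t by (intro mult_right_mono) auto
  ultimately show ?thesis using le by (simp add: defs algebra_simps)
qed

text \<open>The coefficients of the recurrence together with a fixed parameter sequence \<open>\<xi>\<close> of the
  chain sequence \<open>d\<close>. As in the definition of a chain sequence, \<open>d 0\<close> is arbitrary.\<close>

locale chain_parameters =
  fixes \<omega> :: real and \<rho> c d \<xi> :: "nat \<Rightarrow> real"
  assumes rho: "\<rho> n \<ge> 1"
    and xi_0: "0 \<le> \<xi> 0" "\<xi> 0 < 1"
    and xi_Suc: "0 < \<xi> (Suc n)" "\<xi> (Suc n) < 1"
    and d_Suc: "d (Suc n) = (1 - \<xi> n) * \<xi> (Suc n)"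
begin

abbreviation P :: "nat \<Rightarrow> real poly" where "P \<equiv> RII_poly \<omega> \<rho> c d"

lemma xi_less_1: "\<xi> n < 1"
  using xi_0 xi_Suc by (cases n) auto

text \<open>The ratio is meaningful only together with the nonvanishing of its denominator, and that
  follows from the bound one step earlier; hence both are proved in one induction. At \<open>z = \<i>\<omega>\<close>,
  where the coefficient of $P_{n-1}$ vanishes, no separate argument is needed.\<close>

lemma RII_ratio_Im:
  assumes z: "Im z > 0"
  shows "cpoly (P n) z \<noteq> 0 \<and> Im (cpoly (P (Suc n)) z / cpoly (P n) z) \<ge> (1 - \<xi> n) * Im z"
proof (induction n)
  case 0
  have "(1 - \<xi> 0) * Im z \<le> \<rho> 0 * Im z"
    using rho[of 0] xi_0 z by (intro mult_right_mono) auto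
  then show ?case by (simp add: cpoly_smult map_poly_pCons mult.commute)
next
  case (Suc n)
  let ?R = "cpoly (P (Suc n)) z / cpoly (P n) z"
  have "(1 - \<xi> n) * Im z > 0" using xi_less_1[of n] z by simp
  with Suc have nz: "cpoly (P (Suc n)) z \<noteq> 0" by auto
  then have "cpoly (P (Suc (Suc n))) z / cpoly (P (Suc n)) z =
      of_real (\<rho> (Suc n)) * (z - of_real (c (Suc n)))
      - of_real ((1 - \<xi> n) * \<xi> (Suc n)) * (z\<^sup>2 + of_real (\<omega>\<^sup>2)) / ?R"
    unfolding cpoly_RII_Suc_Suc d_Suc by (simp add: diff_divide_distrib)
  with half_plane_step[OF z, of "1 - \<xi> n" ?R "\<xi> (Suc n)" "\<rho> (Suc n)" "c (Suc n)" \<omega>]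
  show ?case using Suc nz xi_less_1[of n] xi_Suc(1)[of n] rho[of "Suc n"] by simp
qed

lemma RII_combination_nonzero:
  assumes z: "Im z > 0"
  shows "\<not> is_zero_of z (P (Suc n) - smult a (P n))"
proof
  assume "is_zero_of z (P (Suc n) - smult a (P n))"
  then have "cpoly (P (Suc n)) z / cpoly (P n) z = of_real a"
    using RII_ratio_Im[OF z, of n] by (simp add: is_zero_of_def cpoly_diff cpoly_smult field_simps)
  moreover have "(1 - \<xi> n) * Im z > 0" using xi_less_1[of n] z by simp
  ultimately show False using RII_ratio_Im[OF z, of n] by simp
qed

lemma wronskian_RII_Suc:
  "poly (wronskian (P (Suc (Suc n))) (P (Suc n))) x =
     \<rho> (Suc n) * (poly (P (Suc n)) x)\<^sup>2
     - 2 * d (Suc n) * x * poly (P n) x * poly (P (Suc n)) x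
     + d (Suc n) * (x\<^sup>2 + \<omega>\<^sup>2) * poly (wronskian (P (Suc n)) (P n)) x"
  unfolding wronskian_def RII_poly.simps(3)
  by (simp only: pderiv_diff pderiv_mult pderiv_smult pderiv_pCons poly_diff poly_add poly_mult poly_smult poly_pCons poly_0 poly_1)
    (simp add: power2_eq_square algebra_simps)

text \<open>The quantitative bound propagates by itself, but degenerates at zeros of $P_n$. There
  the recurrence \<open>wronskian_RII_Suc\<close> reduces to a positive multiple of the preceding Wronskian,
  so positivity is carried along in the same induction.\<close>

lemma RII_wronskian:
  assumes "\<omega> \<noteq> 0"
  shows "poly (wronskian (P (Suc n)) (P n)) x \<ge> (1 - \<xi> n) * (poly (P n) x)\<^sup>2
         \<and> poly (wronskian (P (Suc n)) (P n)) x > 0"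
proof (induction n)
  case 0
  show ?case using rho[of 0] xi_0
    by (simp add: wronskian_def pderiv_smult pderiv_pCons)
next
  case (Suc n)
  define a b W g k where "a = poly (P n) x" "b = poly (P (Suc n)) x"
    "W = poly (wronskian (P (Suc n)) (P n)) x" "g = 1 - \<xi> n" "k = \<xi> (Suc n)"
  note defs = this
  have g: "g > 0" and k: "k > 0" "k < 1" and d: "d (Suc n) = g * k"
    using xi_less_1[of n] xi_Suc[of n] d_Suc[of n] by (auto simp: defs)
  have W: "W \<ge> g * a\<^sup>2" "W > 0" using Suc by (auto simp: defs)
  have dpos: "g * k * (x\<^sup>2 + \<omega>\<^sup>2) > 0"
    using g k assms by (simp add: add_nonneg_pos)
  have eq: "poly (wronskian (P (Suc (Suc n))) (P (Suc n))) x =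
      \<rho> (Suc n) * b\<^sup>2 - 2 * (g * k) * x * a * b + g * k * (x\<^sup>2 + \<omega>\<^sup>2) * W"
    unfolding wronskian_RII_Suc d by (simp add: defs)
  have "g * k * (x\<^sup>2 + \<omega>\<^sup>2) * (g * a\<^sup>2) \<le> g * k * (x\<^sup>2 + \<omega>\<^sup>2) * W"
    using W dpos by (intro mult_left_mono) auto
  moreover have "1 * b\<^sup>2 \<le> \<rho> (Suc n) * b\<^sup>2" using rho[of "Suc n"] by (intro mult_right_mono) auto
  \<comment> \<open>What remains of the lower bound after splitting off \<open>(1 - k) * b\<^sup>2\<close>, using \<open>d (Suc n) = g * k\<close>.\<close>
  moreover have "0 \<le> k * (b - g * x * a)\<^sup>2 + k * g\<^sup>2 * \<omega>\<^sup>2 * a\<^sup>2" using k by simp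
  ultimately have ge: "poly (wronskian (P (Suc (Suc n))) (P (Suc n))) x \<ge> (1 - k) * b\<^sup>2"
    unfolding eq by (simp add: power2_eq_square algebra_simps)
  have "poly (wronskian (P (Suc (Suc n))) (P (Suc n))) x > 0"
  proof (cases "b = 0")
    case True
    then show ?thesis unfolding eq using dpos W by simp
  next
    case False
    then have "(1 - k) * b\<^sup>2 > 0" using k by simp
    then show ?thesis using ge by linarith
  qed
  with ge show ?case by (simp add: defs)
qed

theorem RII_combinations_interlace:
  fixes n :: nat and a b :: real
  assumes "\<omega> \<noteq> 0" "a \<noteq> b"
  defines "p \<equiv> P (Suc n) - smult a (P n)" and "q \<equiv> P (Suc n) - smult b (P n)"
  shows "no_common_zeros p q \<and> zeros_interlace p q"
  unfolding p_def q_def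
proof (rule interlaceI)
  fix t
  show "poly (wronskian (P (Suc n) - smult a (P n)) (P (Suc n) - smult b (P n))) t \<noteq> 0"
    using RII_wronskian[OF assms(1), of n t] assms(2) by (simp add: wronskian_diff_smult)
qed (simp_all add: RII_combination_nonzero)

end

section \<open>Interlacing of the zeros of the two families\<close>

theorem theorem4p5:
  fixes \<omega> :: real and \<rho> c d \<alpha> \<beta> :: "nat \<Rightarrow> real"
    and P L T :: "nat \<Rightarrow> real poly"
  assumes "\<omega> \<noteq> 0"
    and "\<And>n. \<rho> n \<ge> 1"
    and "positive_chain_sequence d"
    and "P = RII_poly \<omega> \<rho> c d"
    and "\<And>n. \<alpha> n \<noteq> 0"
    and "\<And>n. L n = P n - smult (\<alpha> n) (prev_poly P n)"
    and "\<And>n. \<beta> n \<noteq> 0"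
    and "\<And>n. T n = P n - smult (\<beta> n) (prev_poly P n)"
    and "RII_class \<omega> T"
    and "\<And>n. n \<ge> 1 \<Longrightarrow>
           - \<beta> (n - 1) * \<rho> (n - 1) =
             d (n - 1) * \<omega>\<^sup>2 + \<beta> (n - 1) * (\<beta> n + \<rho> (n - 1) * c (n - 1))"
    and "\<And>n. n \<ge> 1 \<Longrightarrow> d n * \<beta> (n - 1) * \<rho> (n - 1) = d (n - 1) * \<beta> n * \<rho> n"
  shows "\<forall>n. (n \<ge> 1 \<longrightarrow> \<alpha> n \<noteq> \<beta> n) \<longrightarrow>
           no_common_zeros (L n) (T n) \<and> zeros_interlace (L n) (T n)"
proof (intro allI impI)
  fix n assume ne: "n \<ge> 1 \<longrightarrow> \<alpha> n \<noteq> \<beta> n"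
  show "no_common_zeros (L n) (T n) \<and> zeros_interlace (L n) (T n)"
  proof (cases n)
    case 0
    have no_zeros: "\<not> is_zero_of z 1" for z by (simp add: is_zero_of_def)
    have "L n = 1" "T n = 1"
      using assms(4,6,8) 0 by (auto simp: prev_poly_def)
    with no_zeros show ?thesis
      by (simp add: no_common_zeros_def zeros_interlace_def zeros_real_simple_def
          consecutive_zeros_def)
  next
    case (Suc m)
    obtain \<xi> where "0 \<le> \<xi> 0 \<and> \<xi> 0 < 1 \<and>
        (\<forall>n\<ge>1. 0 < \<xi> n \<and> \<xi> n < 1 \<and> d n = (1 - \<xi> (n - 1)) * \<xi> n)"
      using assms(3) unfolding positive_chain_sequence_def by blast
    then interpret chain_parameters \<omega> \<rho> c d \<xi>
      using assms(2) by unfold_locales auto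
    show ?thesis
      using RII_combinations_interlace[OF assms(1), of "\<alpha> n" "\<beta> n" m] ne Suc
      unfolding assms(4,6,8) by (simp add: prev_poly_def)
  qed
qed

end
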